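(* Let $L$ be an $m$-dimensional real vector space, let $n\geq 3$, and let $P\in\wedge^{n}L$. Let $k$ be any fixed integer with $1\leq k\leq n-2$. Then $P$ is decomposable if and only if, for every choice of $k$ covectors $\alpha_{1},\dots,\alpha_{k}\in L^{*}$, the $(n-k)$-vector $i(\alpha_{1})\cdots i(\alpha_{k})P$ is decomposable.
   Context: For $\alpha\in L^*$ and $Q\in\wedge^qL$, $i(\alpha)Q\in\wedge^{q-1}L$ denotes the contraction (interior product) of $Q$ with $\alpha$. A $q$-vector $Q\in\wedge^qL$ is decomposable if there are vectors $W_1,\dots,W_q\in L$ such that $Q=W_1\wedge\dots\wedge W_q$; in particular $Q=0$ counts as decomposable. *)

theory Defs
  imports Complex_Main "Jordan_Normal_Form.Determinant"
begin

text \<open>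
  Multivectors on a real vector space \<open>L\<close> (the type \<open>'a\<close>) are rendered as skew-symmetric
  contravariant tensors: for finite-dimensional \<open>L\<close>, the space \<open>\<And>\<^sup>q L\<close> is the space of
  alternating \<open>q\<close>-linear forms on the dual space \<open>L\<^sup>*\<close>. The \<open>q\<close> arguments are passed as a list
  of covectors; lists that are not in \<open>(L\<^sup>*)\<^sup>q\<close> are sent to \<open>0\<close>, so that equality of multivectors
  is equality of functions.
\<close>

definition dual :: "('a::real_vector \<Rightarrow> real) set" where
  "dual = {\<alpha>. linear \<alpha>}"

type_synonym 'a tensor = "('a \<Rightarrow> real) list \<Rightarrow> real"

definition multivectors :: "nat \<Rightarrow> 'a::real_vector tensor set" where
  "multivectors q = {Q.
     (\<forall>\<alpha>s. \<not> (length \<alpha>s = q \<and> set \<alpha>s \<subseteq> dual) \<longrightarrow> Q \<alpha>s = 0) \<and>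
     (\<forall>\<alpha>s \<beta>s. \<forall>\<alpha>\<in>dual. \<forall>\<beta>\<in>dual. \<forall>a b.
        length \<alpha>s + 1 + length \<beta>s = q \<and> set \<alpha>s \<subseteq> dual \<and> set \<beta>s \<subseteq> dual \<longrightarrow>
        Q (\<alpha>s @ (\<lambda>x. a * \<alpha> x + b * \<beta> x) # \<beta>s) = a * Q (\<alpha>s @ \<alpha> # \<beta>s) + b * Q (\<alpha>s @ \<beta> # \<beta>s)) \<and>
     (\<forall>\<alpha>s. length \<alpha>s = q \<and> set \<alpha>s \<subseteq> dual \<and> \<not> distinct \<alpha>s \<longrightarrow> Q \<alpha>s = 0)}"

text \<open>
  \<open>(W\<^sub>1 \<and> \<dots> \<and> W\<^sub>q)(\<alpha>\<^sub>1, \<dots>, \<alpha>\<^sub>q) = det (\<alpha>\<^sub>i(W\<^sub>j))\<close>, without a factor \<open>1/q!\<close>.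
\<close>

definition wedge :: "'a::real_vector list \<Rightarrow> 'a tensor" where
  "wedge Ws = (\<lambda>\<alpha>s. if length \<alpha>s = length Ws \<and> set \<alpha>s \<subseteq> dual
      then det (mat (length Ws) (length Ws) (\<lambda>(i, j). (\<alpha>s ! i) (Ws ! j))) else 0)"

definition decomposable :: "nat \<Rightarrow> 'a::real_vector tensor \<Rightarrow> bool" where
  "decomposable q Q \<longleftrightarrow> (\<exists>Ws. length Ws = q \<and> Q = wedge Ws)"

text \<open>
  The contraction \<open>i(\<alpha>)Q = Q(\<alpha>, \<sqdot>, \<dots>, \<sqdot>)\<close>, for \<open>\<alpha> \<in> L\<^sup>*\<close>.
\<close>

definition contract :: "('a::real_vector \<Rightarrow> real) \<Rightarrow> 'a tensor \<Rightarrow> 'a tensor" where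
  "contract \<alpha> Q = (\<lambda>\<beta>s. Q (\<alpha> # \<beta>s))"

lemma dual_lincomb:
  assumes "\<alpha> \<in> dual" "\<beta> \<in> dual"
  shows "(\<lambda>x. a * \<alpha> x + b * \<beta> x) \<in> dual"
proof -
  have "linear (\<lambda>x. a *\<^sub>R \<alpha> x + b *\<^sub>R \<beta> x)"
    using assms unfolding dual_def
    by (intro linear_compose_add linear_compose_scale_right) auto
  then show ?thesis by (simp add: dual_def)
qed

lemma wedge_in_multivectors:
  fixes Ws :: "'a::real_vector list"
  shows "wedge Ws \<in> multivectors (length Ws)"
proof -
  let ?n = "length Ws"
  let ?M = "\<lambda>\<alpha>s. mat ?n ?n (\<lambda>(i, j). (\<alpha>s ! i) (Ws ! j))"
  have lin: "wedge Ws (\<alpha>s @ (\<lambda>x. a * \<alpha> x + b * \<beta> x) # \<beta>s)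
      = a * wedge Ws (\<alpha>s @ \<alpha> # \<beta>s) + b * wedge Ws (\<alpha>s @ \<beta> # \<beta>s)"
    if *: "\<alpha> \<in> dual" "\<beta> \<in> dual" "length \<alpha>s + 1 + length \<beta>s = ?n"
      "set \<alpha>s \<subseteq> dual" "set \<beta>s \<subseteq> dual"
    for \<alpha>s \<beta>s :: "('a \<Rightarrow> real) list" and \<alpha> \<beta> a b
  proof -
    let ?k = "length \<alpha>s"
    let ?L = "\<lambda>\<gamma>. \<alpha>s @ \<gamma> # \<beta>s"
    have k: "?k < ?n" using * by simp
    have cof: "cofactor (?M (?L \<gamma>)) ?k j = cofactor (?M (?L \<delta>)) ?k j" if "j < ?n" for \<gamma> \<delta> j
      unfolding cofactor_def mat_delete_def
      by (intro arg_cong2[where f="(*)"] refl arg_cong[where f=det] eq_matI)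
        (auto simp: nth_append nth_Cons')
    have ex: "wedge Ws (?L \<gamma>) = (\<Sum>j<?n. \<gamma> (Ws ! j) * cofactor (?M (?L \<alpha>)) ?k j)"
      if "\<gamma> \<in> dual" for \<gamma>
    proof -
      have "wedge Ws (?L \<gamma>) = det (?M (?L \<gamma>))"
        using that * by (simp add: wedge_def)
      also have "\<dots> = (\<Sum>j<?n. ?M (?L \<gamma>) $$ (?k, j) * cofactor (?M (?L \<gamma>)) ?k j)"
        by (rule laplace_expansion_row) (use k in auto)
      also have "\<dots> = (\<Sum>j<?n. \<gamma> (Ws ! j) * cofactor (?M (?L \<alpha>)) ?k j)"
        using k cof[of _ \<gamma> \<alpha>] by (intro sum.cong) auto
      finally show ?thesis .
    qed
    show ?thesis
      using ex[OF dual_lincomb[OF *(1,2), of a b]] ex[OF *(1)] ex[OF *(2)]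
      by (simp add: sum.distrib sum_distrib_left algebra_simps)
  qed
  have alt: "wedge Ws \<alpha>s = 0"
    if *: "length \<alpha>s = ?n" "set \<alpha>s \<subseteq> dual" "\<not> distinct \<alpha>s" for \<alpha>s
  proof -
    from * obtain i j where ij: "i \<noteq> j" "i < ?n" "j < ?n" "\<alpha>s ! i = \<alpha>s ! j"
      unfolding distinct_conv_nth by auto
    have "row (?M \<alpha>s) i = row (?M \<alpha>s) j"
      using ij by (intro eq_vecI) auto
    then have "det (?M \<alpha>s) = 0"
      by (intro det_identical_rows[where n="?n" and i=i and j=j]) (use ij in auto)
    then show ?thesis using * by (simp add: wedge_def)
  qed
  have supp: "\<not> (length \<alpha>s = ?n \<and> set \<alpha>s \<subseteq> dual) \<Longrightarrow> wedge Ws \<alpha>s = 0" for \<alpha>s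
    by (auto simp: wedge_def)
  show ?thesis
    unfolding multivectors_def mem_Collect_eq
    using lin alt supp by blast
qed

lemma contract_in_multivectors:
  fixes Q :: "'a::real_vector tensor"
  assumes "\<alpha> \<in> dual" "Q \<in> multivectors (Suc q)"
  shows "contract \<alpha> Q \<in> multivectors q"
proof -
  have lin: "Q ((\<alpha> # \<alpha>s) @ (\<lambda>x. a * \<gamma> x + b * \<beta> x) # \<beta>s)
      = a * Q ((\<alpha> # \<alpha>s) @ \<gamma> # \<beta>s) + b * Q ((\<alpha> # \<alpha>s) @ \<beta> # \<beta>s)"
    if "\<gamma> \<in> dual" "\<beta> \<in> dual" "length \<alpha>s + 1 + length \<beta>s = q"
      "set \<alpha>s \<subseteq> dual" "set \<beta>s \<subseteq> dual"
    for \<alpha>s \<beta>s :: "('a \<Rightarrow> real) list" and \<gamma> \<beta> a b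
  proof -
    have "length (\<alpha> # \<alpha>s) + 1 + length \<beta>s = Suc q" "set (\<alpha> # \<alpha>s) \<subseteq> dual"
      using that assms(1) by auto
    then show ?thesis
      using assms(2) that unfolding multivectors_def mem_Collect_eq by blast
  qed
  show ?thesis
    using assms lin unfolding multivectors_def mem_Collect_eq contract_def by auto
qed

lemma contract_wedge:
  fixes Ws :: "'a::real_vector list"
  assumes "\<alpha> \<in> dual" "Ws \<noteq> []"
  shows "contract \<alpha> (wedge Ws) =
    (\<lambda>\<beta>s. \<Sum>j<length Ws. (-1) ^ j * \<alpha> (Ws ! j) * wedge (take j Ws @ drop (Suc j) Ws) \<beta>s)"
proof
  fix \<beta>s
  let ?n = "length Ws"
  let ?M = "mat ?n ?n (\<lambda>(i, j). ((\<alpha> # \<beta>s) ! i) (Ws ! j))"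
  have n: "0 < ?n" using assms(2) by simp
  show "contract \<alpha> (wedge Ws) \<beta>s =
    (\<Sum>j<?n. (-1) ^ j * \<alpha> (Ws ! j) * wedge (take j Ws @ drop (Suc j) Ws) \<beta>s)"
  proof (cases "Suc (length \<beta>s) = ?n \<and> set \<beta>s \<subseteq> dual")
    case True
    have "contract \<alpha> (wedge Ws) \<beta>s = det ?M"
      using True assms by (simp add: contract_def wedge_def)
    also have "\<dots> = (\<Sum>j<?n. ?M $$ (0, j) * cofactor ?M 0 j)"
      by (rule laplace_expansion_row) (use n in auto)
    also have "\<dots> = (\<Sum>j<?n. (-1) ^ j * \<alpha> (Ws ! j) * wedge (take j Ws @ drop (Suc j) Ws) \<beta>s)"
    proof (intro sum.cong refl)
      fix j assume "j \<in> {..<?n}"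
      then have j: "j < ?n" by simp
      have len: "length (take j Ws @ drop (Suc j) Ws) = ?n - 1" using j by simp
      have "mat_delete ?M 0 j
          = mat (?n - 1) (?n - 1) (\<lambda>(i, l). (\<beta>s ! i) ((take j Ws @ drop (Suc j) Ws) ! l))"
        using j True unfolding mat_delete_def
        by (intro eq_matI) (auto simp: nth_append min_def)
      then have "cofactor ?M 0 j = (-1) ^ j * wedge (take j Ws @ drop (Suc j) Ws) \<beta>s"
        unfolding cofactor_def wedge_def len using True by auto
      then show "?M $$ (0, j) * cofactor ?M 0 j
          = (-1) ^ j * \<alpha> (Ws ! j) * wedge (take j Ws @ drop (Suc j) Ws) \<beta>s"
        using j n by simp
    qed
    finally show ?thesis .
  next
    case False
    have "length (take j Ws @ drop (Suc j) Ws) = ?n - 1" if "j < ?n" for j using that by simp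
    then have "wedge (take j Ws @ drop (Suc j) Ws) \<beta>s = 0" if "j < ?n" for j
      using False n that by (auto simp: wedge_def)
    then have "(\<Sum>j<?n. (-1) ^ j * \<alpha> (Ws ! j) * wedge (take j Ws @ drop (Suc j) Ws) \<beta>s) = 0"
      by (intro sum.neutral) simp
    moreover have "contract \<alpha> (wedge Ws) \<beta>s = 0"
      using False by (auto simp: contract_def wedge_def)
    ultimately show ?thesis by simp
  qed
qed

end

theory Submission
  imports Defs "HOL-Library.Multiset"
begin

text \<open>
  Call the support space of an \<open>n\<close>-vector \<open>P \<noteq> 0\<close> the smallest subspace \<open>S\<close> of \<open>L\<close> with
  \<open>P \<in> \<And>\<^sup>n S\<close>; its annihilator in \<open>L\<^sup>*\<close> is \<open>{\<beta>. i(\<beta>)P = 0}\<close>. The dimension of \<open>S\<close> is at least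
  \<open>n\<close>, and \<open>P\<close> is decomposable exactly if it equals \<open>n\<close>. This is tested on covectors as follows.
  Suppose that \<open>P(\<alpha>\<^sub>1, \<dots>, \<alpha>\<^sub>n) \<noteq> 0\<close>. The \<open>n\<close> vectors obtained from \<open>P\<close> by inserting all but one of
  the \<open>\<alpha>\<^sub>j\<close> are linearly independent and lie in \<open>S\<close>. Let \<open>N\<close> be their annihilator, of codimension
  \<open>n\<close>; it is a complement in \<open>L\<^sup>*\<close> of the span of the \<open>\<alpha>\<^sub>j\<close>. Hence \<open>P\<close> is decomposable if and only if
  every \<open>\<beta> \<in> N\<close> satisfies \<open>i(\<beta>)P = 0\<close>, and then \<open>P\<close> is a multiple of the wedge of those vectors.
  This criterion (\<open>decomposable_iff_minimal_rank\<close>, with \<open>N\<close> called \<open>pivot_kernel\<close>) reduces the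
  theorem to statements about values of an alternating form.

  That contractions of a decomposable \<open>P\<close> are decomposable follows because a covector in the
  pivot kernel for \<open>i(\<alpha>)P\<close> can be moved into the pivot kernel for \<open>P\<close> by adding a multiple of
  \<open>\<alpha>\<close>, which changes nothing once \<open>\<alpha>\<close> has been inserted.

  For the converse let \<open>n \<ge> 3\<close> and let all \<open>i(\<alpha>)P\<close> be decomposable. Take \<open>\<beta> \<in> N\<close>. For each \<open>a\<close>
  among the \<open>\<alpha>\<^sub>j\<close> the criterion for \<open>i(a)P\<close> gives \<open>P(\<beta>, a, \<dots>) = 0\<close>. So it remains to see that
  \<open>P(\<beta>, \<gamma>, \<dots>) = 0\<close> for a second \<open>\<gamma> \<in> N\<close>, where no pivot need occur among the arguments. Here one
  contracts with \<open>a + \<beta>\<close> instead of \<open>a\<close>: the value on the remaining pivots is unchanged and not zero,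
  and \<open>\<gamma>\<close> stays in the pivot kernel, since \<open>P(\<beta>, \<gamma>, \<dots>)\<close> vanishes as soon as one more pivot is
  present. That a further pivot is present is where \<open>n \<ge> 3\<close> enters. The criterion for
  \<open>i(a + \<beta>)P\<close> then yields \<open>0 = P(a, \<gamma>, \<dots>) + P(\<beta>, \<gamma>, \<dots>) = P(\<beta>, \<gamma>, \<dots>)\<close>
  (\<open>minimal_rank_if_contractions\<close>). Several contractions are handled one at a time.
\<close>

section \<open>Alternating forms on the dual space\<close>

lemma multivector_support:
  assumes "P \<in> multivectors n" "P xs \<noteq> 0"
  shows "length xs = n" "set xs \<subseteq> dual" "distinct xs"
  using assms unfolding multivectors_def by blast+

lemma multivector_linear:
  assumes P: "P \<in> multivectors n" and "\<alpha> \<in> dual" "\<beta> \<in> dual"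
  shows "P (ps @ (\<lambda>x. a * \<alpha> x + b * \<beta> x) # qs) = a * P (ps @ \<alpha> # qs) + b * P (ps @ \<beta> # qs)"
proof (cases "length ps + 1 + length qs = n \<and> set ps \<subseteq> dual \<and> set qs \<subseteq> dual")
  case True
  then show ?thesis using assms unfolding multivectors_def mem_Collect_eq by blast
next
  case False
  then have "P (ps @ \<gamma> # qs) = 0" for \<gamma>
    using multivector_support(1,2)[OF P, of "ps @ \<gamma> # qs"] by auto
  then show ?thesis by simp
qed

lemma dual_add: "\<alpha> \<in> dual \<Longrightarrow> \<beta> \<in> dual \<Longrightarrow> (\<lambda>x. \<alpha> x + \<beta> x) \<in> dual"
  using dual_lincomb[of \<alpha> \<beta> 1 1] by simp

lemma dual_diff: "\<alpha> \<in> dual \<Longrightarrow> \<beta> \<in> dual \<Longrightarrow> (\<lambda>x. \<alpha> x - \<beta> x) \<in> dual"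
  using dual_lincomb[of \<alpha> \<beta> 1 "-1"] by simp

lemma dual_zero: "(\<lambda>x. 0) \<in> dual"
  by (simp add: dual_def linear_zero)

lemma dual_sum:
  assumes "finite A" "\<And>a. a \<in> A \<Longrightarrow> f a \<in> dual"
  shows "(\<lambda>x. \<Sum>a\<in>A. c a * f a x) \<in> dual"
  using assms
proof (induction A)
  case empty
  then show ?case by (simp add: dual_zero)
next
  case (insert a A)
  then show ?case using dual_lincomb[of "f a" "\<lambda>x. \<Sum>a\<in>A. c a * f a x" "c a" 1] by simp
qed

lemma multivector_add:
  assumes "P \<in> multivectors n" "\<alpha> \<in> dual" "\<beta> \<in> dual"
  shows "P (ps @ (\<lambda>x. \<alpha> x + \<beta> x) # qs) = P (ps @ \<alpha> # qs) + P (ps @ \<beta> # qs)"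
  using multivector_linear[OF assms, of ps 1 1 qs] by simp

lemma multivector_diff:
  assumes "P \<in> multivectors n" "\<alpha> \<in> dual" "\<beta> \<in> dual"
  shows "P (ps @ (\<lambda>x. \<alpha> x - \<beta> x) # qs) = P (ps @ \<alpha> # qs) - P (ps @ \<beta> # qs)"
  using multivector_linear[OF assms, of ps 1 "-1" qs] by simp

lemma multivector_zero:
  assumes "P \<in> multivectors n"
  shows "P (ps @ (\<lambda>x. 0) # qs) = 0"
  using multivector_linear[OF assms dual_zero dual_zero, of ps 0 0 qs] by simp

lemma multivector_sum:
  assumes P: "P \<in> multivectors n" and "finite A" "\<And>a. a \<in> A \<Longrightarrow> f a \<in> dual"
  shows "P (ps @ (\<lambda>x. \<Sum>a\<in>A. c a * f a x) # qs) = (\<Sum>a\<in>A. c a * P (ps @ f a # qs))"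
  using assms(2,3)
proof (induction A)
  case empty
  then show ?case by (simp add: multivector_zero[OF P])
next
  case (insert a A)
  then show ?case
    using multivector_linear[OF P _ dual_sum[of A f c], of "f a" ps "c a" 1 qs] by simp
qed

lemma multivector_swap:
  assumes P: "P \<in> multivectors n"
  shows "P (ps @ a # b # qs) = - P (ps @ b # a # qs)"
proof (cases "a \<in> dual \<and> b \<in> dual")
  case True
  then have d: "a \<in> dual" "b \<in> dual" by auto
  let ?s = "\<lambda>x. a x + b x"
  have nd: "P (ps @ c # c # qs) = 0" for c
    using multivector_support(3)[OF P, of "ps @ c # c # qs"] by auto
  have "0 = P (ps @ ?s # ?s # qs)" by (simp add: nd)
  also have "\<dots> = P (ps @ a # ?s # qs) + P (ps @ b # ?s # qs)"
    by (rule multivector_add[OF P d])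
  also have "\<dots> = P (ps @ a # b # qs) + P (ps @ b # a # qs)"
    using multivector_add[OF P d, of "ps @ [a]" qs] multivector_add[OF P d, of "ps @ [b]" qs]
    by (simp add: nd)
  finally show ?thesis by simp
next
  case False
  then have "P (ps @ a # b # qs) = 0" "P (ps @ b # a # qs) = 0"
    using multivector_support(2)[OF P, of "ps @ a # b # qs"]
      multivector_support(2)[OF P, of "ps @ b # a # qs"] by auto
  then show ?thesis by simp
qed

lemma multivector_abs_perm:
  assumes P: "P \<in> multivectors n" and "mset xs = mset ys"
  shows "\<bar>P (ps @ xs)\<bar> = \<bar>P (ps @ ys)\<bar>"
  using assms(2)
proof (induction xs arbitrary: ps ys)
  case Nil
  then show ?case by simp
next
  case (Cons x xs)
  have "x \<in> set ys" using Cons.prems by (metis list.set_intros(1) mset_eq_setD)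
  then obtain us vs where ys: "ys = us @ x # vs" by (meson split_list)
  have front: "\<bar>P (qs @ us @ x # vs)\<bar> = \<bar>P (qs @ x # us @ vs)\<bar>" for qs
  proof (induction us arbitrary: qs)
    case (Cons u us)
    show ?case
      using Cons.IH[of "qs @ [u]"] multivector_swap[OF P, of qs u x "us @ vs"] by simp
  qed simp
  have "\<bar>P ((ps @ [x]) @ xs)\<bar> = \<bar>P ((ps @ [x]) @ us @ vs)\<bar>"
    using Cons.prems ys by (intro Cons.IH) simp
  then show ?case using front[of ps] ys by simp
qed

lemma multivector_perm_zero_iff:
  assumes "P \<in> multivectors n" "mset xs = mset ys"
  shows "P xs = 0 \<longleftrightarrow> P ys = 0"
  using multivector_abs_perm[OF assms, of "[]"] by (metis abs_eq_0 append_Nil)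

lemma multivectors_minus:
  assumes P: "P \<in> multivectors n" and Q: "Q \<in> multivectors n"
  shows "(\<lambda>xs. P xs - Q xs) \<in> multivectors n"
proof -
  have "P xs = 0 \<and> Q xs = 0" if "\<not> (length xs = n \<and> set xs \<subseteq> dual \<and> distinct xs)" for xs
    using multivector_support[OF P] multivector_support[OF Q] that by blast
  then have "P xs - Q xs = 0" if "\<not> (length xs = n \<and> set xs \<subseteq> dual \<and> distinct xs)" for xs
    using that by simp
  moreover have "P (ps @ (\<lambda>x. a * \<alpha> x + b * \<beta> x) # qs) - Q (ps @ (\<lambda>x. a * \<alpha> x + b * \<beta> x) # qs)
      = a * (P (ps @ \<alpha> # qs) - Q (ps @ \<alpha> # qs)) + b * (P (ps @ \<beta> # qs) - Q (ps @ \<beta> # qs))"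
    if "\<alpha> \<in> dual" "\<beta> \<in> dual" for \<alpha> \<beta> a b ps qs
    using that by (simp add: multivector_linear[OF P] multivector_linear[OF Q] algebra_simps)
  ultimately show ?thesis
    unfolding multivectors_def mem_Collect_eq by blast
qed

section \<open>The pivot kernel and the rank criterion\<close>

text \<open>
  If \<open>P \<alpha>s \<noteq> 0\<close>, this is the annihilator of the vectors obtained from \<open>P\<close> by inserting all but one
  of the covectors \<open>\<alpha>s\<close>. The length of \<open>ys\<close> is left free, since \<open>P\<close> vanishes on lists of the wrong
  length.
\<close>

definition pivot_kernel :: "'a::real_vector tensor \<Rightarrow> ('a \<Rightarrow> real) list \<Rightarrow> ('a \<Rightarrow> real) set" where
  "pivot_kernel P \<alpha>s = {\<beta>\<in>dual. \<forall>ys. set ys \<subseteq> set \<alpha>s \<longrightarrow> P (\<beta> # ys) = 0}"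

text \<open>
  For \<open>P \<noteq> 0\<close> this says that the support space of \<open>P\<close> has the least possible dimension. Any one
  tuple of pivots would decide that; quantifying over all of them lets the criterion be used at
  whichever tuple a contraction provides. It holds vacuously for \<open>P = 0\<close>, in agreement with \<open>0\<close>
  being decomposable in positive degree.
\<close>

definition minimal_rank :: "'a::real_vector tensor \<Rightarrow> bool" where
  "minimal_rank P \<longleftrightarrow>
     (\<forall>\<alpha>s. P \<alpha>s \<noteq> 0 \<longrightarrow> (\<forall>\<beta>\<in>pivot_kernel P \<alpha>s. \<forall>ys. P (\<beta> # ys) = 0))"

lemma minimal_rankD:
  "minimal_rank P \<Longrightarrow> P \<alpha>s \<noteq> 0 \<Longrightarrow> \<beta> \<in> pivot_kernel P \<alpha>s \<Longrightarrow> P (\<beta> # ys) = 0"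
  unfolding minimal_rank_def by blast

text \<open>
  Among the lists of pivots only those that omit exactly one pivot matter: repetitions give \<open>0\<close>,
  and the order affects the sign alone.
\<close>

lemma pivot_kernelI:
  assumes P: "P \<in> multivectors n" and ne: "P \<alpha>s \<noteq> 0" and "\<beta> \<in> dual"
    and zero: "\<And>a. a \<in> set \<alpha>s \<Longrightarrow> P (\<beta> # remove1 a \<alpha>s) = 0"
  shows "\<beta> \<in> pivot_kernel P \<alpha>s"
proof -
  note \<alpha>s = multivector_support[OF P ne]
  have "P (\<beta> # ys) = 0" if sub: "set ys \<subseteq> set \<alpha>s" for ys
  proof (rule ccontr)
    assume "P (\<beta> # ys) \<noteq> 0"
    note ys = multivector_support[OF P this]
    have "card (set ys) + 1 = n" "card (set \<alpha>s) = n"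
      using ys \<alpha>s by (auto simp: distinct_card)
    then have "card (set \<alpha>s - set ys) = 1" using sub by (subst card_Diff_subset) auto
    then obtain a where a: "set \<alpha>s - set ys = {a}" by (auto simp: card_1_singleton_iff)
    then have "set ys = set (remove1 a \<alpha>s)" using sub \<alpha>s by auto
    then have "mset ys = mset (remove1 a \<alpha>s)"
      using ys \<alpha>s by (intro iffD1[OF set_eq_iff_mset_eq_distinct]) auto
    then have "P (\<beta> # ys) = 0 \<longleftrightarrow> P (\<beta> # remove1 a \<alpha>s) = 0"
      by (intro multivector_perm_zero_iff[OF P]) simp
    then show False using a zero \<open>P (\<beta> # ys) \<noteq> 0\<close> by blast
  qed
  then show ?thesis using \<open>\<beta> \<in> dual\<close> by (simp add: pivot_kernel_def)
qed

text \<open>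
  The coefficient of \<open>a\<close> in the projection of \<open>\<gamma>\<close> to the span of the pivots along the pivot kernel,
  by Cramer's rule.
\<close>

definition pivot_coeff ::
    "'a::real_vector tensor \<Rightarrow> ('a \<Rightarrow> real) list \<Rightarrow> ('a \<Rightarrow> real) \<Rightarrow> ('a \<Rightarrow> real) \<Rightarrow> real" where
  "pivot_coeff P \<alpha>s \<gamma> a = P (\<gamma> # remove1 a \<alpha>s) / P (a # remove1 a \<alpha>s)"

lemma remove_pivot_nonzero:
  assumes P: "P \<in> multivectors n" and "P \<alpha>s \<noteq> 0" "a \<in> set \<alpha>s"
  shows "P (a # remove1 a \<alpha>s) \<noteq> 0"
  using multivector_perm_zero_iff[OF P, of "a # remove1 a \<alpha>s" \<alpha>s] assms by simp

lemma pivot_coeff_pivot: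
  assumes P: "P \<in> multivectors n" and ne: "P \<alpha>s \<noteq> 0" and ab: "a \<in> set \<alpha>s" "b \<in> set \<alpha>s"
  shows "pivot_coeff P \<alpha>s b a = (if a = b then 1 else 0)"
proof (cases "a = b")
  case True
  then show ?thesis using remove_pivot_nonzero[OF P ne] ab by (simp add: pivot_coeff_def)
next
  case False
  then have "b \<in> set (remove1 a \<alpha>s)" using ab multivector_support(3)[OF P ne] by auto
  then have "P (b # remove1 a \<alpha>s) = 0"
    using multivector_support(3)[OF P, of "b # remove1 a \<alpha>s"] by auto
  then show ?thesis using False by (simp add: pivot_coeff_def)
qed

lemma pivot_projection:
  assumes P: "P \<in> multivectors n" and ne: "P \<alpha>s \<noteq> 0" and \<gamma>: "\<gamma> \<in> dual"
  shows "(\<lambda>x. \<gamma> x - (\<Sum>a\<in>set \<alpha>s. pivot_coeff P \<alpha>s \<gamma> a * a x)) \<in> pivot_kernel P \<alpha>s"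
proof (rule pivot_kernelI[OF P ne])
  let ?s = "\<lambda>x. \<Sum>a\<in>set \<alpha>s. pivot_coeff P \<alpha>s \<gamma> a * a x"
  note \<alpha>s = multivector_support[OF P ne]
  have s: "?s \<in> dual" using dual_sum[of "set \<alpha>s" "\<lambda>a. a"] \<alpha>s by auto
  show "(\<lambda>x. \<gamma> x - ?s x) \<in> dual" by (rule dual_diff[OF \<gamma> s])
  fix b assume b: "b \<in> set \<alpha>s"
  let ?r = "remove1 b \<alpha>s"
  have nz: "P (b # ?r) \<noteq> 0" by (rule remove_pivot_nonzero[OF P ne b])
  have other: "P (a # ?r) = 0" if "a \<in> set \<alpha>s - {b}" for a
    using multivector_support(3)[OF P, of "a # ?r"] that \<alpha>s by auto
  have "P (?s # ?r) = (\<Sum>a\<in>set \<alpha>s. pivot_coeff P \<alpha>s \<gamma> a * P (a # ?r))"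
    using multivector_sum[OF P, of "set \<alpha>s" "\<lambda>a. a" "[]"] \<alpha>s by auto
  also have "\<dots> = pivot_coeff P \<alpha>s \<gamma> b * P (b # ?r)"
    using b other by (subst sum.remove[of _ b]) auto
  also have "\<dots> = P (\<gamma> # ?r)" using nz by (simp add: pivot_coeff_def)
  finally show "P ((\<lambda>x. \<gamma> x - ?s x) # ?r) = 0"
    using multivector_diff[OF P \<gamma> s, of "[]" ?r] by simp
qed

text \<open>
  Uniqueness of the top form on the quotient by \<open>N\<close>: a form that does not see \<open>N\<close> is determined by
  its value on a tuple that spans a complement of \<open>N\<close>.
\<close>

lemma multivector_zeroI:
  assumes F: "F \<in> multivectors n" and \<alpha>s: "F \<alpha>s = 0" "length \<alpha>s = n" "set \<alpha>s \<subseteq> dual"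
    "distinct \<alpha>s"
    and null: "\<And>\<beta> ys. \<beta> \<in> N \<Longrightarrow> F (\<beta> # ys) = 0"
    and split: "\<And>\<gamma>. \<gamma> \<in> dual \<Longrightarrow> \<exists>c. (\<lambda>x. \<gamma> x - (\<Sum>a\<in>set \<alpha>s. c a * a x)) \<in> N"
  shows "F xs = 0"
proof -
  have "F (ps @ qs) = 0" if "set ps \<subseteq> set \<alpha>s" for ps qs
    using that
  proof (induction qs arbitrary: ps)
    case Nil
    show ?case
    proof (rule ccontr)
      assume "\<not> ?case"
      then have ps: "length ps = n" "distinct ps" "F ps \<noteq> 0"
        using multivector_support[OF F, of ps] by auto
      then have "set ps = set \<alpha>s"
        using Nil \<alpha>s by (intro card_subset_eq) (auto simp: distinct_card)
      then have "mset ps = mset \<alpha>s" using ps \<alpha>s set_eq_iff_mset_eq_distinct by blast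
      then show False using multivector_perm_zero_iff[OF F] ps \<alpha>s by blast
    qed
  next
    case (Cons \<gamma> qs)
    show ?case
    proof (cases "\<gamma> \<in> dual")
      case True
      then obtain c where c: "(\<lambda>x. \<gamma> x - (\<Sum>a\<in>set \<alpha>s. c a * a x)) \<in> N" using split by blast
      let ?s = "\<lambda>x. \<Sum>a\<in>set \<alpha>s. c a * a x"
      have s: "?s \<in> dual" using dual_sum[of "set \<alpha>s" "\<lambda>a. a"] \<alpha>s by auto
      have "F (ps @ (\<lambda>x. \<gamma> x - ?s x) # qs) = 0"
        using null[OF c, of "ps @ qs"]
          multivector_perm_zero_iff[OF F, of "ps @ (\<lambda>x. \<gamma> x - ?s x) # qs"
            "(\<lambda>x. \<gamma> x - ?s x) # ps @ qs"] by simp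
      then have "F (ps @ \<gamma> # qs) = F (ps @ ?s # qs)"
        using multivector_diff[OF F True s, of ps qs] by simp
      also have "\<dots> = (\<Sum>a\<in>set \<alpha>s. c a * F (ps @ a # qs))"
        using multivector_sum[OF F, of "set \<alpha>s" "\<lambda>a. a"] \<alpha>s by auto
      also have "\<dots> = 0"
        using Cons.IH[of "ps @ [a]" for a] Cons.prems by (intro sum.neutral) simp
      finally show ?thesis .
    next
      case False
      then show ?thesis using multivector_support(2)[OF F, of "ps @ \<gamma> # qs"] by auto
    qed
  qed
  from this[of "[]" xs] show ?thesis by simp
qed

section \<open>Decomposable multivectors are those of minimal rank\<close>

lemma wedge_list_update:
  assumes "\<beta> \<in> dual" "length \<alpha>s = length Ws" "set \<alpha>s \<subseteq> dual" "i < length Ws"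
  shows "wedge Ws (\<alpha>s[i := \<beta>]) = (\<Sum>j<length Ws. \<beta> (Ws ! j) *
    cofactor (mat (length Ws) (length Ws) (\<lambda>(i, j). (\<alpha>s ! i) (Ws ! j))) i j)"
proof -
  let ?n = "length Ws"
  let ?M = "\<lambda>\<alpha>s. mat ?n ?n (\<lambda>(i, j). (\<alpha>s ! i) (Ws ! j))"
  have cof: "cofactor (?M (\<alpha>s[i := \<beta>])) i j = cofactor (?M \<alpha>s) i j" for j
    unfolding cofactor_def mat_delete_def
    by (intro arg_cong2[where f="(*)"] refl arg_cong[where f=det] eq_matI)
      (auto simp: nth_list_update)
  have "set (\<alpha>s[i := \<beta>]) \<subseteq> dual" using assms set_update_subset_insert[of \<alpha>s i \<beta>] by auto
  then have "wedge Ws (\<alpha>s[i := \<beta>]) = det (?M (\<alpha>s[i := \<beta>]))"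
    using assms by (simp add: wedge_def)
  also have "\<dots> = (\<Sum>j<?n. ?M (\<alpha>s[i := \<beta>]) $$ (i, j) * cofactor (?M (\<alpha>s[i := \<beta>])) i j)"
    by (rule laplace_expansion_row) (use assms in auto)
  also have "\<dots> = (\<Sum>j<?n. \<beta> (Ws ! j) * cofactor (?M \<alpha>s) i j)"
    using assms by (intro sum.cong) (auto simp: cof)
  finally show ?thesis .
qed

lemma wedge_annihilator:
  assumes "\<And>W. W \<in> set Ws \<Longrightarrow> \<beta> W = 0"
  shows "wedge Ws (\<beta> # ys) = 0"
proof (cases "Suc (length ys) = length Ws")
  case True
  let ?n = "length Ws"
  let ?M = "mat ?n ?n (\<lambda>(i, j). ((\<beta> # ys) ! i) (Ws ! j))"
  have n: "0 < ?n" using True by linarith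
  have "det ?M = (\<Sum>j<?n. ?M $$ (0, j) * cofactor ?M 0 j)"
    by (rule laplace_expansion_row) (use n in auto)
  also have "\<dots> = 0" using assms n by (intro sum.neutral) simp
  finally show ?thesis by (simp add: wedge_def)
qed (simp add: wedge_def)

text \<open>
  Let \<open>A\<close> be the invertible matrix of the values \<open>\<alpha>\<^sub>i(W\<^sub>j)\<close>. For \<open>\<beta>\<close> in the pivot kernel the row
  vector of the \<open>\<beta>(W\<^sub>j)\<close> is annihilated by the adjugate of \<open>A\<close>, hence is \<open>0\<close>.
\<close>

lemma wedge_minimal_rank: "minimal_rank (wedge Ws)"
  unfolding minimal_rank_def
proof (intro allI impI ballI)
  fix \<alpha>s \<beta> ys
  assume ne: "wedge Ws \<alpha>s \<noteq> 0" and \<beta>: "\<beta> \<in> pivot_kernel (wedge Ws) \<alpha>s"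
  let ?n = "length Ws"
  define A where "A = mat ?n ?n (\<lambda>(i, j). (\<alpha>s ! i) (Ws ! j))"
  note P = wedge_in_multivectors[of Ws]
  note \<alpha>s = multivector_support[OF P ne]
  have A: "A \<in> carrier_mat ?n ?n" by (simp add: A_def)
  have det: "det A \<noteq> 0" using ne \<alpha>s by (simp add: A_def wedge_def)
  have kernel: "(\<Sum>j<?n. \<beta> (Ws ! j) * cofactor A i j) = 0" if i: "i < ?n" for i
  proof -
    have "mset (\<alpha>s[i := \<beta>]) = mset (\<beta> # remove1 (\<alpha>s ! i) \<alpha>s)"
      using i \<alpha>s by (simp add: mset_update)
    moreover have "wedge Ws (\<beta> # remove1 (\<alpha>s ! i) \<alpha>s) = 0"
      using \<beta> set_remove1_subset[of "\<alpha>s ! i" \<alpha>s] by (simp add: pivot_kernel_def)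
    ultimately have "wedge Ws (\<alpha>s[i := \<beta>]) = 0"
      using multivector_perm_zero_iff[OF P] by blast
    then show ?thesis
      using wedge_list_update[of \<beta> \<alpha>s Ws i] \<beta> \<alpha>s i by (simp add: A_def pivot_kernel_def)
  qed
  have "\<beta> (Ws ! l) = 0" if l: "l < ?n" for l
  proof -
    have adj: "(\<Sum>i<?n. cofactor A i j * A $$ (i, l)) = (if j = l then det A else 0)"
      if j: "j < ?n" for j
    proof -
      have "(\<Sum>i<?n. cofactor A i j * A $$ (i, l)) = (adj_mat A * A) $$ (j, l)"
        using j l A by (auto simp: times_mat_def scalar_prod_def adj_mat_def atLeast0LessThan)
      then show ?thesis using adj_mat(3)[OF A] j l by simp
    qed
    have "\<beta> (Ws ! l) * det A = (\<Sum>j<?n. \<beta> (Ws ! j) * (if j = l then det A else 0))"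
      using l by (simp add: if_distrib[where f="\<lambda>x. _ * x"] sum.delta' cong: if_cong)
    also have "\<dots> = (\<Sum>j<?n. \<beta> (Ws ! j) * (\<Sum>i<?n. cofactor A i j * A $$ (i, l)))"
      by (intro sum.cong) (auto simp: adj)
    also have "\<dots> = (\<Sum>j<?n. \<Sum>i<?n. A $$ (i, l) * (\<beta> (Ws ! j) * cofactor A i j))"
      by (simp add: sum_distrib_left mult_ac)
    also have "\<dots> = (\<Sum>i<?n. A $$ (i, l) * (\<Sum>j<?n. \<beta> (Ws ! j) * cofactor A i j))"
      by (subst sum.swap) (simp add: sum_distrib_left)
    also have "\<dots> = 0" by (simp add: kernel)
    finally show ?thesis using det by simp
  qed
  then show "wedge Ws (\<beta> # ys) = 0"
    by (intro wedge_annihilator) (auto simp: in_set_conv_nth)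
qed

text \<open>
  The canonical map from \<open>L\<close> to its bidual is onto. The vector is assembled from the values of
  \<open>f\<close> on the coordinate functions of a basis.
\<close>

lemma linear_functional_on_dual_is_evaluation:
  fixes B :: "'a::real_vector set" and f :: "('a \<Rightarrow> real) \<Rightarrow> real"
  assumes fd: "finite_dimensional_vector_space ((*\<^sub>R) :: real \<Rightarrow> 'a \<Rightarrow> 'a) B"
    and f: "\<And>c :: 'a \<Rightarrow> real. \<And>g. (\<And>b. b \<in> B \<Longrightarrow> g b \<in> dual) \<Longrightarrow>
      f (\<lambda>x. \<Sum>b\<in>B. c b * g b x) = (\<Sum>b\<in>B. c b * f (g b))"
  shows "\<exists>W. \<forall>\<beta>\<in>dual. f \<beta> = \<beta> W"
proof -
  have B: "finite B" "independent B" "span B = UNIV"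
    using finite_dimensional_vector_space.finite_Basis[OF fd]
      finite_dimensional_vector_space.independent_Basis[OF fd]
      finite_dimensional_vector_space.span_Basis[OF fd]
    by (simp_all add: dependent_raw_def span_raw_def)
  let ?r = "\<lambda>b x. real_vector.representation B x b"
  have r: "?r b \<in> dual" for b
    unfolding dual_def using B
    by (auto intro!: linearI simp: real_vector.representation_add real_vector.representation_scale)
  have expand: "(\<Sum>b\<in>B. ?r b x *\<^sub>R b) = x" for x
    using B by (intro real_vector.sum_representation_eq) auto
  have "f \<beta> = \<beta> (\<Sum>b\<in>B. f (?r b) *\<^sub>R b)" if "\<beta> \<in> dual" for \<beta>
  proof -
    have lin: "linear \<beta>" using that by (simp add: dual_def)
    have "\<beta> x = (\<Sum>b\<in>B. \<beta> b * ?r b x)" for x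
    proof -
      have "\<beta> x = \<beta> (\<Sum>b\<in>B. ?r b x *\<^sub>R b)" by (simp add: expand)
      also have "\<dots> = (\<Sum>b\<in>B. \<beta> b * ?r b x)"
        by (simp add: linear_sum[OF lin] linear_scale[OF lin] mult.commute)
      finally show ?thesis .
    qed
    then have "\<beta> = (\<lambda>x. \<Sum>b\<in>B. \<beta> b * ?r b x)" by blast
    then have "f \<beta> = f (\<lambda>x. \<Sum>b\<in>B. \<beta> b * ?r b x)" by simp
    also have "\<dots> = (\<Sum>b\<in>B. \<beta> b * f (?r b))" by (rule f) (rule r)
    also have "\<dots> = \<beta> (\<Sum>b\<in>B. f (?r b) *\<^sub>R b)"
      by (simp add: linear_sum[OF lin] linear_scale[OF lin] mult.commute)
    finally show ?thesis .
  qed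
  then show ?thesis by blast
qed

text \<open>
  With pivots normalised to \<open>P \<alpha>s = 1\<close>, the coefficient functionals of the projection are evaluations
  at vectors \<open>W a\<close> dual to the pivots. Both \<open>P\<close> and the wedge of these vectors vanish on the pivot
  kernel and equal \<open>1\<close> on the pivots, so they agree.
\<close>

lemma decomposable_if_minimal_rank:
  fixes B :: "'a::real_vector set" and P :: "'a tensor"
  assumes fd: "finite_dimensional_vector_space ((*\<^sub>R) :: real \<Rightarrow> 'a \<Rightarrow> 'a) B"
    and P: "P \<in> multivectors n" and "0 < n" and D: "minimal_rank P"
  shows "decomposable n P"
proof (cases "\<exists>\<alpha>s. P \<alpha>s \<noteq> 0")
  case False
  have "wedge (replicate n (0 :: 'a)) xs = 0" for xs
  proof (rule ccontr)
    assume ne: "wedge (replicate n (0 :: 'a)) xs \<noteq> 0"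
    note xs = multivector_support[OF wedge_in_multivectors ne]
    then obtain \<beta> ys where [simp]: "xs = \<beta> # ys" using \<open>0 < n\<close> by (cases xs) auto
    have "\<beta> 0 = 0" using xs by (auto simp: dual_def linear_0)
    then show False using ne wedge_annihilator[of "replicate n 0" \<beta> ys] by simp
  qed
  then have "P = wedge (replicate n 0)" using False by force
  then show ?thesis unfolding decomposable_def by (intro exI[of _ "replicate n 0"]) simp
next
  case True
  then obtain \<alpha>\<^sub>0 \<alpha>s' where ne0: "P (\<alpha>\<^sub>0 # \<alpha>s') \<noteq> 0"
    using multivector_support(1)[OF P] \<open>0 < n\<close>
    by (metis length_0_conv neq_Nil_conv less_numeral_extra(3))
  define \<alpha>s where "\<alpha>s = (\<lambda>x. 1 / P (\<alpha>\<^sub>0 # \<alpha>s') * \<alpha>\<^sub>0 x + 0 * \<alpha>\<^sub>0 x) # \<alpha>s'"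
  have "\<alpha>\<^sub>0 \<in> dual" using multivector_support(2)[OF P ne0] by simp
  then have one: "P \<alpha>s = 1"
    using multivector_linear[OF P, of \<alpha>\<^sub>0 \<alpha>\<^sub>0 "[]" "1 / P (\<alpha>\<^sub>0 # \<alpha>s')" 0 \<alpha>s'] ne0
    by (simp add: \<alpha>s_def)
  then have ne: "P \<alpha>s \<noteq> 0" by simp
  note \<alpha>s = multivector_support[OF P ne]
  have "\<exists>W. \<forall>\<beta>\<in>dual. pivot_coeff P \<alpha>s \<beta> a = \<beta> W" for a
  proof (rule linear_functional_on_dual_is_evaluation[OF fd])
    fix c :: "'a \<Rightarrow> real" and g :: "'a \<Rightarrow> 'a \<Rightarrow> real"
    assume "\<And>b. b \<in> B \<Longrightarrow> g b \<in> dual"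
    then show "pivot_coeff P \<alpha>s (\<lambda>x. \<Sum>b\<in>B. c b * g b x) a
        = (\<Sum>b\<in>B. c b * pivot_coeff P \<alpha>s (g b) a)"
      using multivector_sum[OF P finite_dimensional_vector_space.finite_Basis[OF fd],
          of g "[]" c "remove1 a \<alpha>s"]
      by (simp add: pivot_coeff_def sum_divide_distrib)
  qed
  then obtain W where W: "pivot_coeff P \<alpha>s \<beta> a = \<beta> (W a)" if "\<beta> \<in> dual" for \<beta> a
    by metis
  have dualW: "b (W a) = (if a = b then 1 else 0)" if "a \<in> set \<alpha>s" "b \<in> set \<alpha>s" for a b
    using pivot_coeff_pivot[OF P ne that] W[of b a] that \<alpha>s by auto
  let ?Ws = "map W \<alpha>s"
  have Q: "wedge ?Ws \<in> multivectors n" using wedge_in_multivectors[of ?Ws] \<alpha>s by simp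
  have "mat n n (\<lambda>(i, j). (\<alpha>s ! i) (?Ws ! j)) = 1\<^sub>m n"
    using \<alpha>s by (intro eq_matI) (auto simp: dualW nth_eq_iff_index_eq)
  then have wedge_one: "wedge ?Ws \<alpha>s = 1" using \<alpha>s by (simp add: wedge_def)
  define N where "N = {\<beta> \<in> pivot_kernel P \<alpha>s. \<forall>a\<in>set \<alpha>s. \<beta> (W a) = 0}"
  have "P xs - wedge ?Ws xs = 0" for xs
  proof (rule multivector_zeroI[OF multivectors_minus[OF P Q], where N = N])
    show "P \<alpha>s - wedge ?Ws \<alpha>s = 0" by (simp add: one wedge_one)
    show "P (\<beta> # ys) - wedge ?Ws (\<beta> # ys) = 0" if "\<beta> \<in> N" for \<beta> ys
      using that minimal_rankD[OF D ne] wedge_annihilator[of ?Ws \<beta> ys] by (auto simp: N_def)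
    show "\<exists>c. (\<lambda>x. \<gamma> x - (\<Sum>a\<in>set \<alpha>s. c a * a x)) \<in> N" if \<gamma>: "\<gamma> \<in> dual" for \<gamma>
    proof
      have "(\<Sum>a\<in>set \<alpha>s. pivot_coeff P \<alpha>s \<gamma> a * a (W b)) = \<gamma> (W b)" if "b \<in> set \<alpha>s" for b
      proof -
        have "(\<Sum>a\<in>set \<alpha>s. pivot_coeff P \<alpha>s \<gamma> a * a (W b))
            = (\<Sum>a\<in>set \<alpha>s. if b = a then \<gamma> (W a) else 0)"
          using that by (intro sum.cong) (auto simp: W[OF \<gamma>] dualW)
        then show ?thesis using that by simp
      qed
      then show "(\<lambda>x. \<gamma> x - (\<Sum>a\<in>set \<alpha>s. pivot_coeff P \<alpha>s \<gamma> a * a x)) \<in> N"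
        using pivot_projection[OF P ne \<gamma>] by (simp add: N_def)
    qed
  qed (use \<alpha>s in auto)
  then have "P = wedge ?Ws" by force
  then show ?thesis using \<alpha>s unfolding decomposable_def by (intro exI[of _ ?Ws]) simp
qed

lemma decomposable_iff_minimal_rank:
  fixes B :: "'a::real_vector set" and P :: "'a tensor"
  assumes "finite_dimensional_vector_space ((*\<^sub>R) :: real \<Rightarrow> 'a \<Rightarrow> 'a) B"
    and "P \<in> multivectors n" and "0 < n"
  shows "decomposable n P \<longleftrightarrow> minimal_rank P"
  using decomposable_if_minimal_rank[OF assms] wedge_minimal_rank
  by (auto simp: decomposable_def)

section \<open>Contractions\<close>

text \<open>
  A covector in the pivot kernel of \<open>i(\<alpha>)P\<close> has no components along the pivots other than \<open>\<alpha>\<close>,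
  so its projection to the pivot kernel of \<open>P\<close> differs from it by a multiple of \<open>\<alpha>\<close>.
\<close>

lemma minimal_rank_contract:
  assumes P: "P \<in> multivectors n" and D: "minimal_rank P"
  shows "minimal_rank (contract \<alpha> P)"
  unfolding minimal_rank_def
proof (intro allI impI ballI)
  fix \<alpha>s \<beta> ys
  assume "contract \<alpha> P \<alpha>s \<noteq> 0" and \<beta>: "\<beta> \<in> pivot_kernel (contract \<alpha> P) \<alpha>s"
  then have ne: "P (\<alpha> # \<alpha>s) \<noteq> 0" by (simp add: contract_def)
  let ?S = "set (\<alpha> # \<alpha>s)" and ?c = "pivot_coeff P (\<alpha> # \<alpha>s) \<beta>"
  note \<alpha>s = multivector_support[OF P ne]
  have \<beta>d: "\<beta> \<in> dual" using \<beta> by (simp add: pivot_kernel_def)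
  let ?s = "\<lambda>x. \<Sum>a\<in>?S. ?c a * a x"
  have s: "?s \<in> dual" by (rule dual_sum[of ?S "\<lambda>a. a"]) (use \<alpha>s in auto)
  have c0: "?c a = 0" if "a \<in> set \<alpha>s" for a
  proof -
    have "a \<noteq> \<alpha>" using that \<alpha>s by auto
    moreover have "P (\<alpha> # \<beta> # remove1 a \<alpha>s) = 0"
      using \<beta> set_remove1_subset[of a \<alpha>s] by (simp add: pivot_kernel_def contract_def)
    ultimately show ?thesis
      using multivector_swap[OF P, of "[]" \<beta> \<alpha> "remove1 a \<alpha>s"] by (simp add: pivot_coeff_def)
  qed
  have rep: "P (\<alpha> # \<alpha> # ys) = 0" using multivector_support(3)[OF P, of "\<alpha> # \<alpha> # ys"] by auto
  have "P ((\<lambda>x. \<beta> x - ?s x) # \<alpha> # ys) = 0"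
    by (rule minimal_rankD[OF D ne pivot_projection[OF P ne \<beta>d]])
  then have "P (\<beta> # \<alpha> # ys) = P (?s # \<alpha> # ys)"
    using multivector_diff[OF P \<beta>d s, of "[]" "\<alpha> # ys"] by simp
  also have "\<dots> = (\<Sum>a\<in>?S. ?c a * P (a # \<alpha> # ys))"
    using multivector_sum[OF P, of ?S "\<lambda>a. a" "[]"] \<alpha>s by auto
  also have "\<dots> = 0" using c0 rep by (intro sum.neutral) auto
  finally show "contract \<alpha> P (\<beta> # ys) = 0"
    using multivector_swap[OF P, of "[]" \<alpha> \<beta> ys] by (simp add: contract_def)
qed

text \<open>
  For \<open>\<beta>\<close> in the pivot kernel, the form \<open>i(\<beta>)P\<close> vanishes as soon as one pivot is inserted
  (\<open>with_pivot\<close>, by contracting \<open>P\<close> with that pivot) or one further element of the pivot kernel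
  (\<open>two_kernel\<close>, by contracting \<open>P\<close> with a pivot perturbed by \<open>\<beta>\<close>). These covectors span \<open>L\<^sup>*\<close>.
\<close>

lemma minimal_rank_if_contractions:
  fixes P :: "'a::real_vector tensor"
  assumes P: "P \<in> multivectors n" and "3 \<le> n"
    and D: "\<And>\<alpha>. \<alpha> \<in> dual \<Longrightarrow> minimal_rank (contract \<alpha> P)"
  shows "minimal_rank P"
  unfolding minimal_rank_def
proof (intro allI impI ballI)
  fix \<alpha>s \<beta> xs
  assume ne: "P \<alpha>s \<noteq> 0" and \<beta>: "\<beta> \<in> pivot_kernel P \<alpha>s"
  note \<alpha>s = multivector_support[OF P ne]
  have kernel_dual: "\<eta> \<in> dual" if "\<eta> \<in> pivot_kernel P \<alpha>s" for \<eta>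
    using that by (simp add: pivot_kernel_def)
  have with_pivot: "P (\<eta> # a # ys) = 0"
    if \<eta>: "\<eta> \<in> pivot_kernel P \<alpha>s" and a: "a \<in> set \<alpha>s" for \<eta> a ys
  proof -
    have ad: "a \<in> dual" using a \<alpha>s by auto
    have "\<eta> \<in> pivot_kernel (contract a P) (remove1 a \<alpha>s)"
      unfolding pivot_kernel_def contract_def
    proof (clarsimp simp: kernel_dual[OF \<eta>])
      fix zs assume "set zs \<subseteq> set (remove1 a \<alpha>s)"
      then have "set (a # zs) \<subseteq> set \<alpha>s" using a set_remove1_subset[of a \<alpha>s] by auto
      then have "P (\<eta> # a # zs) = 0" using \<eta> unfolding pivot_kernel_def by blast
      then show "P (a # \<eta> # zs) = 0"
        using multivector_swap[OF P, of "[]" a \<eta> zs] by simp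
    qed
    then have "contract a P (\<eta> # ys) = 0"
      using remove_pivot_nonzero[OF P ne a]
      by (intro minimal_rankD[OF D[OF ad], of "remove1 a \<alpha>s"]) (simp_all add: contract_def)
    then show ?thesis
      using multivector_swap[OF P, of "[]" \<eta> a ys] by (simp add: contract_def)
  qed
  have two_kernel: "P (\<beta> # \<gamma> # ys) = 0" if \<gamma>: "\<gamma> \<in> pivot_kernel P \<alpha>s" for \<gamma> ys
  proof -
    have "\<alpha>s \<noteq> []" using \<alpha>s \<open>3 \<le> n\<close> by auto
    then obtain a where a: "a \<in> set \<alpha>s" by (cases \<alpha>s) auto
    then have ad: "a \<in> dual" using \<alpha>s by auto
    let ?Q = "contract (\<lambda>x. a x + \<beta> x) P"
    have Q: "?Q zs = P (a # zs) + P (\<beta> # zs)" for zs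
      using multivector_add[OF P ad kernel_dual[OF \<beta>], of "[]" zs] by (simp add: contract_def)
    have "P (\<beta> # remove1 a \<alpha>s) = 0"
      using \<beta> set_remove1_subset[of a \<alpha>s] by (simp add: pivot_kernel_def)
    then have Qne: "?Q (remove1 a \<alpha>s) \<noteq> 0" using remove_pivot_nonzero[OF P ne a] by (simp add: Q)
    have first: "P (a # \<gamma> # zs) = 0" for zs
      using with_pivot[OF \<gamma> a, of zs] multivector_swap[OF P, of "[]" a \<gamma> zs] by simp
    have second: "P (\<beta> # \<gamma> # zs) = 0" if zs: "set zs \<subseteq> set (remove1 a \<alpha>s)" for zs
    proof (cases zs)
      case Nil
      \<comment> \<open>The list then has only two entries, fewer than \<open>n\<close>.\<close>
      then show ?thesis
        using multivector_support(1)[OF P, of "\<beta> # \<gamma> # zs"] \<open>3 \<le> n\<close> by auto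
    next
      case (Cons z zs')
      then have "z \<in> set \<alpha>s" using zs set_remove1_subset[of a \<alpha>s] by auto
      then show ?thesis
        using with_pivot[OF \<beta>, of z "\<gamma> # zs'"] multivector_swap[OF P, of "[\<beta>]" \<gamma> z zs'] Cons
        by simp
    qed
    have "\<gamma> \<in> pivot_kernel ?Q (remove1 a \<alpha>s)"
      using first second kernel_dual[OF \<gamma>] by (simp add: pivot_kernel_def Q)
    then have "?Q (\<gamma> # ys) = 0"
      by (rule minimal_rankD[OF D[OF dual_add[OF ad kernel_dual[OF \<beta>]]] Qne])
    then show ?thesis by (simp add: Q first)
  qed
  show "P (\<beta> # xs) = 0"
  proof (rule ccontr)
    assume nz: "P (\<beta> # xs) \<noteq> 0"
    note sup = multivector_support[OF P nz]
    then obtain \<gamma> ys where xs: "xs = \<gamma> # ys" using \<open>3 \<le> n\<close> by (cases xs) auto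
    have \<gamma>: "\<gamma> \<in> dual" using sup xs by auto
    let ?c = "pivot_coeff P \<alpha>s \<gamma>"
    let ?s = "\<lambda>x. \<Sum>a\<in>set \<alpha>s. ?c a * a x"
    have s: "?s \<in> dual" by (rule dual_sum[of "set \<alpha>s" "\<lambda>a. a"]) (use \<alpha>s in auto)
    have "P (\<beta> # ?s # ys) = (\<Sum>a\<in>set \<alpha>s. ?c a * P (\<beta> # a # ys))"
      using multivector_sum[OF P, of "set \<alpha>s" "\<lambda>a. a" "[\<beta>]"] \<alpha>s by auto
    also have "\<dots> = 0" using with_pivot[OF \<beta>] by (intro sum.neutral) auto
    finally have "P (\<beta> # \<gamma> # ys) = P (\<beta> # (\<lambda>x. \<gamma> x - ?s x) # ys)"
      using multivector_diff[OF P \<gamma> s, of "[\<beta>]" ys] by simp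
    also have "\<dots> = 0" by (rule two_kernel[OF pivot_projection[OF P ne \<gamma>]])
    finally show False using nz xs by simp
  qed
qed

lemma foldr_contract_in_multivectors:
  assumes "P \<in> multivectors n" "set \<alpha>s \<subseteq> dual" "length \<alpha>s \<le> n"
  shows "foldr contract \<alpha>s P \<in> multivectors (n - length \<alpha>s)"
  using assms(2,3)
proof (induction \<alpha>s)
  case Nil
  then show ?case using assms(1) by simp
next
  case (Cons \<alpha> \<alpha>s)
  then have "foldr contract \<alpha>s P \<in> multivectors (Suc (n - length (\<alpha> # \<alpha>s)))"
    by (simp add: Suc_diff_Suc)
  then show ?case using Cons.prems by (simp add: contract_in_multivectors)
qed

lemma minimal_rank_foldr_contract:
  assumes P: "P \<in> multivectors n" and D: "minimal_rank P"
    and "set \<alpha>s \<subseteq> dual" "length \<alpha>s \<le> n"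
  shows "minimal_rank (foldr contract \<alpha>s P)"
  using assms(3,4)
proof (induction \<alpha>s)
  case (Cons \<alpha> \<alpha>s)
  then show ?case
    using minimal_rank_contract[OF foldr_contract_in_multivectors[OF P, of \<alpha>s]] by simp
qed (simp add: D)

lemma minimal_rank_if_iterated_contractions:
  assumes P: "P \<in> multivectors n" and "k + 2 \<le> n"
    and "\<And>\<alpha>s. length \<alpha>s = k \<Longrightarrow> set \<alpha>s \<subseteq> dual \<Longrightarrow> minimal_rank (foldr contract \<alpha>s P)"
  shows "minimal_rank P"
  using assms(2,3)
proof (induction k)
  case 0
  then show ?case using "0.prems"(2)[of "[]"] by simp
next
  case (Suc k)
  show ?case
  proof (rule Suc.IH)
    fix \<alpha>s :: "('a \<Rightarrow> real) list"
    assume \<alpha>s: "length \<alpha>s = k" "set \<alpha>s \<subseteq> dual"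
    show "minimal_rank (foldr contract \<alpha>s P)"
    proof (rule minimal_rank_if_contractions)
      show "foldr contract \<alpha>s P \<in> multivectors (n - k)"
        using foldr_contract_in_multivectors[OF P, of \<alpha>s] \<alpha>s Suc.prems(1) by simp
      show "3 \<le> n - k" using Suc.prems(1) by simp
      show "minimal_rank (contract \<alpha> (foldr contract \<alpha>s P))" if "\<alpha> \<in> dual" for \<alpha>
        using Suc.prems(2)[of "\<alpha> # \<alpha>s"] that \<alpha>s by simp
    qed
  qed (use Suc.prems in simp)
qed

theorem lemma3:
  fixes B :: "'a::real_vector set" and P :: "'a tensor" and m n k :: nat
  assumes "finite_dimensional_vector_space ((*\<^sub>R) :: real \<Rightarrow> 'a \<Rightarrow> 'a) B"
    and "dim (UNIV :: 'a set) = m"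
    and "3 \<le> n"
    and "P \<in> multivectors n"
    and "1 \<le> k" and "k \<le> n - 2"
  shows "decomposable n P \<longleftrightarrow>
    (\<forall>\<alpha>s. length \<alpha>s = k \<and> set \<alpha>s \<subseteq> dual \<longrightarrow> decomposable (n - k) (foldr contract \<alpha>s P))"
proof -
  have kn: "k + 2 \<le> n" using assms(3,6) by linarith
  have crit: "decomposable (n - k) (foldr contract \<alpha>s P) \<longleftrightarrow> minimal_rank (foldr contract \<alpha>s P)"
    if "length \<alpha>s = k" "set \<alpha>s \<subseteq> dual" for \<alpha>s
    using foldr_contract_in_multivectors[OF assms(4) that(2)] that kn
    by (intro decomposable_iff_minimal_rank[OF assms(1)]) auto
  have "decomposable n P \<longleftrightarrow> minimal_rank P"
    using assms(3) by (intro decomposable_iff_minimal_rank[OF assms(1,4)]) simp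
  moreover have "minimal_rank P \<longleftrightarrow>
      (\<forall>\<alpha>s. length \<alpha>s = k \<and> set \<alpha>s \<subseteq> dual \<longrightarrow> minimal_rank (foldr contract \<alpha>s P))"
    using minimal_rank_foldr_contract[OF assms(4)] kn
      minimal_rank_if_iterated_contractions[OF assms(4) kn] by auto
  ultimately show ?thesis using crit by blast
qed

end
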